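(* The generalised Poincaré constant $\zeta\mapsto\alpha_{\mathrm{gPI}}(\zeta)$ is continuous on $\mathcal P_+(\mathcal Z)$. Moreover, for any $\zeta\in\mathcal P_+(\mathcal Z)$, $$\alpha_{\mathrm{gPI}}(\zeta)=\inf_{\substack{f\in\langle\mathbf 1\rangle^{\perp_\zeta}\\ \|f\|_\zeta=1}}\mathscr E_\zeta(f)=\inf_{\substack{f\in\langle\mathbf 1\rangle^{\perp}\\ \|f\|=1}}\frac{\mathscr E_\zeta(f)}{\operatorname{var}_\zeta(f)}.$$ In addition, for any $\zeta\in\mathcal P_+(\mathcal Z)$, any family $\zeta_\varepsilon\in\mathcal P_+(\mathcal Z)$ with $\zeta_\varepsilon\to\zeta$ and any $\delta_\varepsilon>0$ with $\delta_\varepsilon\to0$ as $\varepsilon\to0$, $$\alpha_{\mathrm{gPI}}(\zeta)=\frac12\lim_{\varepsilon\to0}\ \inf_{\substack{\varphi\in\mathcal D_{\zeta_\varepsilon}(\mathcal Z)\\ 0<\|\varphi-\mathbf 1\|_{\zeta_\varepsilon}<\delta_\varepsilon}}\frac{\mathscr R_{\zeta_\varepsilon}(\varphi)}{\mathscr H_{\zeta_\varepsilon}(\varphi)}.$$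
   Context: $\mathcal Z$ is a finite set with $|\mathcal Z|\ge2$. $M\in\mathbb R^{|\mathcal Z|\times|\mathcal Z|}$ is a fixed irreducible generator (transition rate matrix: off-diagonal entries $\ge0$, rows sum to $0$), not necessarily reversible. $\mathcal P_+(\mathcal Z)$ is the set of strictly positive probability measures on $\mathcal Z$, viewed as vectors in $\mathbb R^{|\mathcal Z|}$. $\mathbf 1$ is the constant function $1$ and $\langle\mathbf 1\rangle$ its span. For $\zeta\in\mathcal P_+(\mathcal Z)$: $\mathbb E_\zeta[f]=\sum_z f(z)\zeta(z)$; $\operatorname{var}_\zeta(f)=\mathbb E_\zeta[f^2]-(\mathbb E_\zeta[f])^2$; $\|f\|_\zeta^2=\sum_z f(z)^2\zeta(z)$; $\|f\|^2=\sum_z f(z)^2$; $\langle\mathbf 1\rangle^{\perp_\zeta}=\{f:\sum_z f(z)\zeta(z)=0\}$; $\langle\mathbf 1\rangle^{\perp}=\{f:\sum_z f(z)=0\}$; $\mathcal D_\zeta(\mathcal Z)=\{\varphi\in\mathbb R^{|\mathcal Z|}:\varphi(z)>0\ \forall z,\ \mathbb E_\zeta[\varphi]=1\}$; $\mathscr H_\zeta(\varphi)=\sum_z\varphi(z)\log\varphi(z)\,\zeta(z)$. Generalised Dirichlet form, for $f\in\mathbb R^{|\mathcal Z|}$: $\mathscr E_\zeta(f)=\tfrac12\sum_{z,z'}M(z,z')\zeta(z)(f(z)-f(z'))^2$. Generalised Fisher information, for $\varphi\in\mathcal D_\zeta(\mathcal Z)$: $\mathscr R_\zeta(\varphi)=\sum_{z,z'}M(z,z')\zeta(z)\varphi(z)\bigl[\tfrac{\varphi(z')}{\varphi(z)}-1-\log\tfrac{\varphi(z')}{\varphi(z)}\bigr]$.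 Generalised Poincaré constant: $\alpha_{\mathrm{gPI}}(\zeta)=\inf_{f\in\mathbb R^{|\mathcal Z|},\,f\notin\langle\mathbf 1\rangle}\mathscr E_\zeta(f)/\operatorname{var}_\zeta(f)$. *)

theory Defs
  imports "HOL-Analysis.Analysis"
begin

text \<open>The finite state space is a type \<open>'z\<close> of class \<open>finite\<close>; functions and measures on it are
  vectors in \<open>real ^ 'z\<close>, with their Euclidean topology. The constant function 1 is \<open>vec 1\<close>.\<close>

definition generator :: "real^'z^'z \<Rightarrow> bool" where
  "generator M \<longleftrightarrow>
     (\<forall>z z'. z \<noteq> z' \<longrightarrow> M$z$z' \<ge> 0) \<and> (\<forall>z. (\<Sum>z'\<in>UNIV. M$z$z') = 0)"

text \<open>Irreducibility: every state is reached from every other along transitions of positive rate.\<close>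

definition irreducible_generator :: "real^'z^'z \<Rightarrow> bool" where
  "irreducible_generator M \<longleftrightarrow>
     generator M \<and> (\<forall>z z'. (z, z') \<in> {(x, y). x \<noteq> y \<and> M$x$y > 0}\<^sup>*)"

definition pos_prob :: "(real^'z) set" where
  "pos_prob = {\<zeta>. (\<forall>z. \<zeta>$z > 0) \<and> (\<Sum>z\<in>UNIV. \<zeta>$z) = 1}"

definition expect :: "real^'z \<Rightarrow> real^'z \<Rightarrow> real" where
  "expect \<zeta> f = (\<Sum>z\<in>UNIV. f$z * \<zeta>$z)"

definition var :: "real^'z \<Rightarrow> real^'z \<Rightarrow> real" where
  "var \<zeta> f = expect \<zeta> (\<chi> z. (f$z)^2) - (expect \<zeta> f)^2"

definition wnorm :: "real^'z \<Rightarrow> real^'z \<Rightarrow> real" where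
  "wnorm \<zeta> f = sqrt (\<Sum>z\<in>UNIV. (f$z)^2 * \<zeta>$z)"

definition one_wperp :: "real^'z \<Rightarrow> (real^'z) set" where
  "one_wperp \<zeta> = {f. (\<Sum>z\<in>UNIV. f$z * \<zeta>$z) = 0}"

definition one_perp :: "(real^'z) set" where
  "one_perp = {f. (\<Sum>z\<in>UNIV. f$z) = 0}"

definition densities :: "real^'z \<Rightarrow> (real^'z) set" where
  "densities \<zeta> = {\<phi>. (\<forall>z. \<phi>$z > 0) \<and> expect \<zeta> \<phi> = 1}"

definition rel_entropy :: "real^'z \<Rightarrow> real^'z \<Rightarrow> real" where
  "rel_entropy \<zeta> \<phi> = (\<Sum>z\<in>UNIV. \<phi>$z * ln (\<phi>$z) * \<zeta>$z)"

definition gen_dirichlet :: "real^'z^'z \<Rightarrow> real^'z \<Rightarrow> real^'z \<Rightarrow> real" where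
  "gen_dirichlet M \<zeta> f =
     1/2 * (\<Sum>z\<in>UNIV. \<Sum>z'\<in>UNIV. M$z$z' * \<zeta>$z * (f$z - f$z')^2)"

definition gen_fisher :: "real^'z^'z \<Rightarrow> real^'z \<Rightarrow> real^'z \<Rightarrow> real" where
  "gen_fisher M \<zeta> \<phi> =
     (\<Sum>z\<in>UNIV. \<Sum>z'\<in>UNIV.
        M$z$z' * \<zeta>$z * \<phi>$z * (\<phi>$z' / \<phi>$z - 1 - ln (\<phi>$z' / \<phi>$z)))"

text \<open>The infimum is the real \<open>Inf\<close>: for a generator on at least two states and \<open>\<zeta> \<in> pos_prob\<close>
  the set of quotients is nonempty and bounded below by 0.\<close>

definition alpha_gPI :: "real^'z^'z \<Rightarrow> real^'z \<Rightarrow> real" where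
  "alpha_gPI M \<zeta> = (INF f\<in>{f. f \<notin> span {vec 1}}. gen_dirichlet M \<zeta> f / var \<zeta> f)"

end

theory Submission
  imports Defs "HOL-Real_Asymp.Real_Asymp"
begin

text \<open>The quotient \<open>E(f) / var(f)\<close> is invariant under \<open>f \<mapsto> t f + a\<close>, so every normalisation that
  can be reached by such a map has the same set of values, hence the same infimum. If
  \<open>\<xi> \<le> c \<zeta>\<close> and \<open>\<zeta> \<le> c \<xi>\<close> pointwise, then \<open>E\<close> and \<open>var\<close> change by at most a factor \<open>c\<close> (the latter
  because \<open>var\<close> is the minimal mean squared deviation from a constant), and the Poincare constant
  by at most \<open>c\<^sup>2\<close>; letting \<open>c\<close> tend to 1 gives continuity without any compactness argument.
  Near \<open>\<phi> = 1\<close> the summands of the Fisher information and of the entropy, the latter rewritten with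
  \<open>\<phi> ln \<phi> - \<phi> + 1\<close>, agree with \<open>(\<phi>(z) - \<phi>(z'))\<^sup>2 / 2\<close> and \<open>(\<phi>(z) - 1)\<^sup>2 / 2\<close> up to factors close
  to 1, so the entropy quotient is comparable with twice the Poincare quotient of \<open>\<phi>\<close>, and
  every nonconstant \<open>f\<close> is an affine image of such a density \<open>\<phi>\<close>.\<close>

section \<open>Limits from multiplicative bounds, and quadratic expansions at 1\<close>

text \<open>For a given \<open>a\<close> on one side of \<open>L\<close>, one \<open>c > 1\<close>
  close to 1 keeps \<open>c ^ n * L\<close> or \<open>L / c ^ n\<close> on the same side of
  \<open>a\<close>. Both bounds are written as products, so \<open>L = 0\<close> needs no separate
  case. The exponent is 2 for continuity and 6 for the entropy limit.\<close>

lemma tendsto_of_multiplicative_bounds: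
  fixes u :: "'a \<Rightarrow> real" and L :: real and n :: nat
  assumes "\<And>c. c > 1 \<Longrightarrow> \<forall>\<^sub>F x in F. u x \<le> c ^ n * L \<and> L \<le> c ^ n * u x"
  shows "(u \<longlongrightarrow> L) F"
proof (rule order_tendstoI)
  fix a assume a: "a < L"
  have "((\<lambda>c::real. L / c ^ n) \<longlongrightarrow> L / 1 ^ n) (at_right 1)"
    by (intro tendsto_intros) auto
  then have "\<forall>\<^sub>F c::real in at_right 1. L / c ^ n > a"
    using a by (intro order_tendstoD) auto
  then have "\<forall>\<^sub>F c::real in at_right 1. L / c ^ n > a \<and> c > 1"
    using eventually_at_right_less by eventually_elim auto
  then obtain c :: real where c: "L / c ^ n > a" "c > 1"
    using eventually_happens trivial_limit_at_right_real by blast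
  show "\<forall>\<^sub>F x in F. a < u x"
    using assms[OF c(2)]
  proof eventually_elim
    case (elim x)
    then have "L / c ^ n \<le> u x"
      using c(2) by (simp add: divide_le_eq mult.commute)
    then show ?case using c(1) by linarith
  qed
next
  fix a assume a: "L < a"
  have "((\<lambda>c::real. c ^ n * L) \<longlongrightarrow> 1 ^ n * L) (at_right 1)"
    by (intro tendsto_intros)
  then have "\<forall>\<^sub>F c::real in at_right 1. c ^ n * L < a"
    using a by (intro order_tendstoD) auto
  then have "\<forall>\<^sub>F c::real in at_right 1. c ^ n * L < a \<and> c > 1"
    using eventually_at_right_less by eventually_elim auto
  then obtain c :: real where c: "c ^ n * L < a" "c > 1"
    using eventually_happens trivial_limit_at_right_real by blast
  show "\<forall>\<^sub>F x in F. u x < a"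
    using assms[OF c(2)] by eventually_elim (use c in auto)
qed

text \<open>Since \<open>1 / (2 * c) < 1/2 < c / 2\<close>, the limit confines
  \<open>h x / x\<^sup>2\<close> to this interval on a punctured neighbourhood of 0; the value
  \<open>h 0 = 0\<close> fills in the centre.\<close>

lemma eventually_quadratic_bounds:
  fixes h :: "real \<Rightarrow> real"
  assumes lim: "((\<lambda>x. h x / x\<^sup>2) \<longlongrightarrow> 1/2) (at 0)" and "h 0 = 0" and c: "c > 1"
  shows "\<exists>\<eta>>0. \<forall>x. \<bar>x\<bar> < \<eta> \<longrightarrow> x\<^sup>2 / 2 \<le> c * h x \<and> h x \<le> c * (x\<^sup>2 / 2)"
proof -
  have "1 / (2 * c) < 1/2" "1/2 < c / 2" using c by (auto simp: field_simps)
  then have "\<forall>\<^sub>F x in at 0. 1 / (2 * c) < h x / x\<^sup>2 \<and> h x / x\<^sup>2 < c / 2"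
    by (intro eventually_conj order_tendstoD[OF lim])
  then obtain \<eta> where \<eta>: "\<eta> > 0"
    "\<And>x. x \<noteq> 0 \<Longrightarrow> \<bar>x\<bar> < \<eta> \<Longrightarrow> 1 / (2 * c) < h x / x\<^sup>2 \<and> h x / x\<^sup>2 < c / 2"
    unfolding eventually_at by (auto simp: dist_real_def)
  have "x\<^sup>2 / 2 \<le> c * h x \<and> h x \<le> c * (x\<^sup>2 / 2)" if "\<bar>x\<bar> < \<eta>" for x
  proof (cases "x = 0")
    case False
    then have "x\<^sup>2 > 0" by simp
    then show ?thesis using \<eta>(2)[OF False that] c by (auto simp: field_simps)
  qed (use assms in auto)
  then show ?thesis using \<eta>(1) by blast
qed

lemma entropy_term_bounds:
  fixes c :: real
  assumes "c > 1"
  shows "\<exists>\<eta>>0. \<forall>a. \<bar>a - 1\<bar> < \<eta> \<longrightarrow>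
    (a - 1)\<^sup>2 / 2 \<le> c * (a * ln a - a + 1) \<and> a * ln a - a + 1 \<le> c * ((a - 1)\<^sup>2 / 2)"
proof -
  have "((\<lambda>x::real. ((1 + x) * ln (1 + x) - x) / x\<^sup>2) \<longlongrightarrow> 1/2) (at 0)"
    by real_asymp
  from eventually_quadratic_bounds[OF this _ assms]
  obtain \<eta> where "\<eta> > 0" and \<eta>: "\<And>x. \<bar>x\<bar> < \<eta> \<Longrightarrow>
      x\<^sup>2 / 2 \<le> c * ((1 + x) * ln (1 + x) - x) \<and> (1 + x) * ln (1 + x) - x \<le> c * (x\<^sup>2 / 2)"
    by auto
  show ?thesis
    using \<open>\<eta> > 0\<close> \<eta>[of "a - 1" for a] by (intro exI[of _ \<eta>]) (simp add: algebra_simps)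
qed

text \<open>With \<open>x = b / a - 1\<close> the Fisher term is
  \<open>a * (x - ln (1 + x))\<close>, close to \<open>a * x\<^sup>2 / 2\<close>, whereas
  \<open>(a - b)\<^sup>2 / 2\<close> equals \<open>a\<^sup>2 * x\<^sup>2 / 2\<close>. One factor
  \<open>c\<close> pays for the expansion of the logarithm, the other for the surplus factor
  \<open>a\<close>, which is near 1.\<close>

lemma fisher_term_bounds:
  fixes c :: real
  assumes c: "c > 1"
  shows "\<exists>\<eta>>0. \<forall>a b. \<bar>a - 1\<bar> < \<eta> \<longrightarrow> \<bar>b - 1\<bar> < \<eta> \<longrightarrow>
    (a - b)\<^sup>2 / 2 \<le> c\<^sup>2 * (a * (b / a - 1 - ln (b / a))) \<and>
    a * (b / a - 1 - ln (b / a)) \<le> c\<^sup>2 * ((a - b)\<^sup>2 / 2)"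
proof -
  have "((\<lambda>x::real. (x - ln (1 + x)) / x\<^sup>2) \<longlongrightarrow> 1/2) (at 0)"
    by real_asymp
  from eventually_quadratic_bounds[OF this _ c]
  obtain \<theta> where "\<theta> > 0" and \<theta>: "\<And>x. \<bar>x\<bar> < \<theta> \<Longrightarrow>
      x\<^sup>2 / 2 \<le> c * (x - ln (1 + x)) \<and> x - ln (1 + x) \<le> c * (x\<^sup>2 / 2)"
    by auto
  \<comment> \<open>The bounds \<open>1/2\<close> and \<open>\<theta> / 4\<close> ensure
    \<open>a > 1/2\<close> and then \<open>\<bar>x\<bar> < \<theta>\<close>; the other two ensure
    \<open>1/c \<le> a \<le> c\<close>.\<close>
  define \<eta> where "\<eta> = min (min (1/2) (\<theta> / 4)) (min (1 - 1/c) (c - 1))"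
  have "1 - 1/c > 0" using c by simp
  then have \<eta>: "\<eta> > 0" "\<eta> \<le> 1/2" "\<eta> \<le> \<theta> / 4" "\<eta> \<le> 1 - 1/c" "\<eta> \<le> c - 1"
    using c \<open>\<theta> > 0\<close> unfolding \<eta>_def by linarith+
  have "(a - b)\<^sup>2 / 2 \<le> c\<^sup>2 * (a * (b / a - 1 - ln (b / a))) \<and>
    a * (b / a - 1 - ln (b / a)) \<le> c\<^sup>2 * ((a - b)\<^sup>2 / 2)"
    if ab: "\<bar>a - 1\<bar> < \<eta>" "\<bar>b - 1\<bar> < \<eta>" for a b
  proof -
    define x where "x = (b - a) / a"
    have a: "a > 1/2" "a \<le> c" "1/c \<le> a" using ab \<eta> by linarith+
    then have ca: "1 \<le> c * a" using c by (simp add: divide_le_eq mult.commute)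
    have "\<bar>b - a\<bar> < 2 * \<eta>" using ab by linarith
    also have "\<dots> \<le> \<theta> / 2" using \<eta> by simp
    also have "\<dots> \<le> \<theta> * a" using a \<open>\<theta> > 0\<close> by simp
    finally have "\<bar>x\<bar> < \<theta>" using a by (simp add: x_def abs_divide field_simps)
    then have bd: "x\<^sup>2 / 2 \<le> c * (x - ln (1 + x))" "x - ln (1 + x) \<le> c * (x\<^sup>2 / 2)"
      using \<theta> by auto
    have eq: "1 + x = b / a" "x = b / a - 1" using a by (auto simp: x_def field_simps)
    have sq: "(a - b)\<^sup>2 = a\<^sup>2 * x\<^sup>2" using a by (simp add: x_def power2_commute power_divide)
    \<comment> \<open>The extra factor \<open>a\<close> is traded for \<open>c\<close>: through
      \<open>a \<le> c\<close> here, through \<open>1 \<le> c * a\<close> in the opposite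
      estimate.\<close>
    have "(a - b)\<^sup>2 / 2 = a * (a * (x\<^sup>2 / 2))" unfolding sq by (simp add: power2_eq_square)
    also have "\<dots> \<le> c * (a * (c * (x - ln (1 + x))))"
      using a c bd by (intro mult_mono) auto
    finally have l: "(a - b)\<^sup>2 / 2 \<le> c * (a * (c * (x - ln (1 + x))))" .
    have "a * (x - ln (1 + x)) \<le> a * (c * (x\<^sup>2 / 2))"
      using a bd by (intro mult_left_mono) auto
    also have "\<dots> \<le> (c * a) * (a * (c * (x\<^sup>2 / 2)))"
      using a c mult_right_mono[OF ca, of "a * (c * (x\<^sup>2 / 2))"] by simp
    also have "\<dots> = c\<^sup>2 * ((a - b)\<^sup>2 / 2)" unfolding sq by (simp add: power2_eq_square)
    finally show ?thesis using l unfolding eq(1) by (simp add: eq(2) power2_eq_square mult_ac)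
  qed
  then show ?thesis using \<eta>(1) by blast
qed

lemma sum_le_multiple:
  fixes f g :: "'a \<Rightarrow> real"
  assumes "\<And>x. x \<in> A \<Longrightarrow> f x \<le> c * g x"
  shows "sum f A \<le> c * sum g A"
  using sum_mono[of A f "\<lambda>x. c * g x"] assms by (simp add: sum_distrib_left)

section \<open>Variance, Dirichlet form and their behaviour under affine maps\<close>

lemma not_in_span_one_iff: "f \<notin> span {vec 1 :: real^'z} \<longleftrightarrow> (\<forall>a. \<exists>z. f$z \<noteq> a)"
  by (auto simp: span_singleton vec_eq_iff)

text \<open>An indicator vector distinguishes two states. Nonemptiness is what allows lower bounds
  to pass to the real \<open>Inf\<close>.\<close>

lemma nonconstant_exists:
  assumes "CARD('z::finite) \<ge> 2"
  shows "{f :: real^'z. f \<notin> span {vec 1}} \<noteq> {}"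
proof -
  obtain x y :: 'z where "x \<noteq> y"
    using assms by (metis (full_types) card_2_iff' ex_card subset_UNIV)
  then have "axis x 1 $ x \<noteq> (axis x 1 :: real^'z) $ y" by (simp add: axis_def)
  then have "axis x 1 \<notin> span {vec 1 :: real^'z}"
    unfolding not_in_span_one_iff by metis
  then show ?thesis by blast
qed

lemma pos_probD:
  assumes "\<zeta> \<in> pos_prob"
  shows "\<zeta>$z > 0" "(\<Sum>z\<in>UNIV. \<zeta>$z) = 1"
  using assms by (auto simp: pos_prob_def)

text \<open>Expanding the square exhibits the variance as the least mean squared deviation from a
  constant. It is applied with \<open>a\<close> the mean (positivity, scaling), the mean under
  another measure (comparison), 0 (centred functions) and 1 (densities).\<close>

lemma sum_squared_deviation:
  assumes "\<zeta> \<in> pos_prob"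
  shows "(\<Sum>z\<in>UNIV. (f$z - a)\<^sup>2 * \<zeta>$z) = var \<zeta> f + (expect \<zeta> f - a)\<^sup>2"
proof -
  have "(\<Sum>z\<in>UNIV. (f$z - a)\<^sup>2 * \<zeta>$z) =
      (\<Sum>z\<in>UNIV. (f$z)\<^sup>2 * \<zeta>$z - 2 * a * (f$z * \<zeta>$z) + a\<^sup>2 * \<zeta>$z)"
    by (intro sum.cong) (auto simp: power2_eq_square algebra_simps)
  also have "\<dots> = expect \<zeta> (\<chi> z. (f$z)\<^sup>2) - 2 * a * expect \<zeta> f + a\<^sup>2"
    using pos_probD(2)[OF assms]
    by (simp add: expect_def sum.distrib sum_subtractf flip: sum_distrib_left)
  finally show ?thesis by (simp add: var_def power2_eq_square algebra_simps)
qed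

lemma var_pos:
  assumes "\<zeta> \<in> pos_prob" "f \<notin> span {vec 1}"
  shows "var \<zeta> f > 0"
proof -
  obtain z where z: "f$z \<noteq> expect \<zeta> f" using assms(2) not_in_span_one_iff by blast
  have "(\<Sum>z\<in>UNIV. (f$z - expect \<zeta> f)\<^sup>2 * \<zeta>$z) > 0"
    by (rule sum_pos2[of _ z]) (use z pos_probD(1)[OF assms(1)] in \<open>auto simp: less_imp_le\<close>)
  then show ?thesis by (simp add: sum_squared_deviation[OF assms(1)])
qed

lemma wnorm_squared:
  assumes "\<zeta> \<in> pos_prob"
  shows "(wnorm \<zeta> f)\<^sup>2 = (\<Sum>z\<in>UNIV. (f$z)\<^sup>2 * \<zeta>$z)"
  using pos_probD(1)[OF assms] by (simp add: wnorm_def sum_nonneg less_imp_le)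

lemma wnorm_nonneg: "\<zeta> \<in> pos_prob \<Longrightarrow> wnorm \<zeta> f \<ge> 0"
  using pos_probD(1)[of \<zeta>] by (simp add: wnorm_def sum_nonneg less_imp_le)

lemma expect_affine:
  assumes "\<zeta> \<in> pos_prob"
  shows "expect \<zeta> (\<chi> z. t * f$z + a) = t * expect \<zeta> f + a"
  using pos_probD(2)[OF assms]
  by (simp add: expect_def algebra_simps sum.distrib flip: sum_distrib_left)

lemma var_affine:
  assumes "\<zeta> \<in> pos_prob"
  shows "var \<zeta> (\<chi> z. t * f$z + a) = t\<^sup>2 * var \<zeta> f"
proof -
  have "var \<zeta> (\<chi> z. t * f$z + a) =
      (\<Sum>z\<in>UNIV. (t * f$z + a - (t * expect \<zeta> f + a))\<^sup>2 * \<zeta>$z)"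
    using sum_squared_deviation[OF assms, of "\<chi> z. t * f$z + a" "t * expect \<zeta> f + a"]
    by (simp add: expect_affine[OF assms])
  also have "\<dots> = (\<Sum>z\<in>UNIV. t\<^sup>2 * ((f$z - expect \<zeta> f)\<^sup>2 * \<zeta>$z))"
    by (intro sum.cong) (auto simp: power2_eq_square algebra_simps)
  also have "\<dots> = t\<^sup>2 * var \<zeta> f"
    using sum_squared_deviation[OF assms, of f "expect \<zeta> f"] by (simp flip: sum_distrib_left)
  finally show ?thesis .
qed

lemma gen_dirichlet_affine:
  "gen_dirichlet M \<zeta> (\<chi> z. t * f$z + a) = t\<^sup>2 * gen_dirichlet M \<zeta> f"
proof -
  have "M$z$z' * \<zeta>$z * (t * f$z + a - (t * f$z' + a))\<^sup>2 =
      t\<^sup>2 * (M$z$z' * \<zeta>$z * (f$z - f$z')\<^sup>2)" for z z'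
    by (simp add: power2_eq_square algebra_simps)
  then show ?thesis
    unfolding gen_dirichlet_def vec_lambda_beta
    by (simp only: mult.left_commute[of "1/2"] flip: sum_distrib_left)
qed

lemma quotient_affine:
  assumes "\<zeta> \<in> pos_prob" "t \<noteq> 0"
  shows "gen_dirichlet M \<zeta> (\<chi> z. t * f$z + a) / var \<zeta> (\<chi> z. t * f$z + a) =
    gen_dirichlet M \<zeta> f / var \<zeta> f"
  using assms by (simp add: gen_dirichlet_affine var_affine)

lemma generatorD: "generator M \<Longrightarrow> z \<noteq> z' \<Longrightarrow> M$z$z' \<ge> 0"
  by (simp add: generator_def)

text \<open>Diagonal rates are nonpositive, but their summands vanish because of the factor
  \<open>f$z - f$z\<close>. The same case split on \<open>z = z'\<close> recurs in the termwise
  estimates below.\<close>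

lemma gen_dirichlet_nonneg:
  assumes "generator M" "\<zeta> \<in> pos_prob"
  shows "gen_dirichlet M \<zeta> f \<ge> 0"
proof -
  have "M$z$z' * \<zeta>$z * (f$z - f$z')\<^sup>2 \<ge> 0" for z z'
    using generatorD[OF assms(1), of z z'] pos_probD(1)[OF assms(2), of z]
    by (cases "z = z'") auto
  then show ?thesis by (simp add: gen_dirichlet_def sum_nonneg)
qed

lemma quotient_nonneg:
  assumes "generator M" "\<zeta> \<in> pos_prob" "f \<notin> span {vec 1}"
  shows "gen_dirichlet M \<zeta> f / var \<zeta> f \<ge> 0"
  using gen_dirichlet_nonneg[OF assms(1,2)] var_pos[OF assms(2,3)] by simp

section \<open>Comparison of Poincare constants and continuity\<close>

lemma alpha_gPI_le:
  assumes "generator M" "\<zeta> \<in> pos_prob" "f \<notin> span {vec 1}"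
  shows "alpha_gPI M \<zeta> \<le> gen_dirichlet M \<zeta> f / var \<zeta> f"
  unfolding alpha_gPI_def
proof (rule cINF_lower)
  show "bdd_below ((\<lambda>f. gen_dirichlet M \<zeta> f / var \<zeta> f) ` {f. f \<notin> span {vec 1}})"
    using quotient_nonneg[OF assms(1,2)] by (intro bdd_belowI[of _ 0]) auto
qed (use assms in auto)

lemma alpha_gPI_greatest:
  fixes M :: "real^'z^'z"
  assumes "CARD('z) \<ge> 2"
    and "\<And>f. f \<notin> span {vec 1} \<Longrightarrow> b \<le> gen_dirichlet M \<zeta> f / var \<zeta> f"
  shows "b \<le> alpha_gPI M \<zeta>"
  unfolding alpha_gPI_def
  using nonconstant_exists[OF assms(1)] assms(2) by (intro cINF_greatest) auto

text \<open>The numerator and the denominator of each quotient contribute one factor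
  \<open>c\<close>. The hypotheses are symmetric in the two measures, so the reverse bound follows
  by exchanging them.\<close>

lemma alpha_gPI_compare:
  fixes M :: "real^'z^'z"
  assumes "CARD('z) \<ge> 2" "generator M" "\<zeta> \<in> pos_prob" "\<xi> \<in> pos_prob" "c > 0"
    and up: "\<And>z. \<xi>$z \<le> c * \<zeta>$z" and lo: "\<And>z. \<zeta>$z \<le> c * \<xi>$z"
  shows "alpha_gPI M \<xi> \<le> c\<^sup>2 * alpha_gPI M \<zeta>"
proof -
  have "alpha_gPI M \<xi> / c\<^sup>2 \<le> gen_dirichlet M \<zeta> f / var \<zeta> f" if f: "f \<notin> span {vec 1}" for f
  proof -
    have term_le: "M$z$z' * \<xi>$z * (f$z - f$z')\<^sup>2 \<le> c * (M$z$z' * \<zeta>$z * (f$z - f$z')\<^sup>2)" for z z'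
    proof (cases "z = z'")
      case False
      then show ?thesis
        using mult_left_mono[OF up[of z], of "M$z$z' * (f$z - f$z')\<^sup>2"]
          generatorD[OF assms(2) False] by (simp add: mult_ac)
    qed auto
    have E: "gen_dirichlet M \<xi> f \<le> c * gen_dirichlet M \<zeta> f"
      unfolding gen_dirichlet_def mult.left_commute[of c]
      by (intro mult_left_mono sum_le_multiple term_le) simp
    \<comment> \<open>Centring at the mean under \<open>\<xi>\<close> can only enlarge the deviation
      under \<open>\<zeta>\<close>, and it gives exactly \<open>var \<xi> f\<close> once the weights
      are exchanged.\<close>
    have "var \<zeta> f \<le> (\<Sum>z\<in>UNIV. (f$z - expect \<xi> f)\<^sup>2 * \<zeta>$z)"
      by (simp add: sum_squared_deviation[OF assms(3)])
    also have "\<dots> \<le> c * (\<Sum>z\<in>UNIV. (f$z - expect \<xi> f)\<^sup>2 * \<xi>$z)"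
      by (rule sum_le_multiple) (metis lo mult.left_commute mult_left_mono zero_le_power2)
    also have "\<dots> = c * var \<xi> f" by (simp add: sum_squared_deviation[OF assms(4)])
    finally have V: "var \<zeta> f \<le> c * var \<xi> f" .
    have "alpha_gPI M \<xi> \<le> gen_dirichlet M \<xi> f / var \<xi> f"
      by (rule alpha_gPI_le[OF assms(2,4) f])
    also have "\<dots> \<le> (c * gen_dirichlet M \<zeta> f) / (var \<zeta> f / c)"
      using E V var_pos[OF assms(3) f] var_pos[OF assms(4) f] \<open>c > 0\<close>
        gen_dirichlet_nonneg[OF assms(2,3), of f]
      by (intro frac_le) (auto simp: divide_le_eq mult.commute)
    also have "\<dots> = c\<^sup>2 * (gen_dirichlet M \<zeta> f / var \<zeta> f)"
      using \<open>c > 0\<close> by (simp add: power2_eq_square)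
    finally show ?thesis using \<open>c > 0\<close> by (simp add: divide_le_eq mult.commute)
  qed
  from alpha_gPI_greatest[OF assms(1) this] show ?thesis
    using \<open>c > 0\<close> by (simp add: divide_le_eq mult.commute)
qed

text \<open>As \<open>\<zeta>$z > 0\<close>, the open interval from \<open>\<zeta>$z / c\<close> to
  \<open>c * \<zeta>$z\<close> is a neighbourhood of \<open>\<zeta>$z\<close>; finitely many states
  permit a common eventuality.\<close>

lemma eventually_componentwise_ratio:
  fixes \<xi> :: "'a \<Rightarrow> real^'z"
  assumes "\<zeta> \<in> pos_prob" "(\<xi> \<longlongrightarrow> \<zeta>) F" "c > 1"
  shows "\<forall>\<^sub>F x in F. \<forall>z. \<xi> x$z \<le> c * \<zeta>$z \<and> \<zeta>$z \<le> c * \<xi> x$z"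
proof (rule eventually_all_finite)
  fix z
  have lim: "((\<lambda>x. \<xi> x$z) \<longlongrightarrow> \<zeta>$z) F" by (rule tendsto_vec_nth[OF assms(2)])
  have "\<zeta>$z / c < \<zeta>$z" "\<zeta>$z < c * \<zeta>$z"
    using pos_probD(1)[OF assms(1), of z] assms(3) by (auto simp: field_simps)
  then have "\<forall>\<^sub>F x in F. \<zeta>$z / c < \<xi> x$z \<and> \<xi> x$z < c * \<zeta>$z"
    by (intro eventually_conj order_tendstoD[OF lim])
  then show "\<forall>\<^sub>F x in F. \<xi> x$z \<le> c * \<zeta>$z \<and> \<zeta>$z \<le> c * \<xi> x$z"
    by eventually_elim (use assms(3) in \<open>auto simp: field_simps\<close>)
qed

lemma eventually_alpha_gPI_bounds:
  fixes M :: "real^'z^'z"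
  assumes "CARD('z) \<ge> 2" "generator M" "\<zeta> \<in> pos_prob"
    and "\<forall>\<^sub>F x in F. \<xi> x \<in> pos_prob" "(\<xi> \<longlongrightarrow> \<zeta>) F" "c > 1"
  shows "\<forall>\<^sub>F x in F. alpha_gPI M (\<xi> x) \<le> c\<^sup>2 * alpha_gPI M \<zeta> \<and>
    alpha_gPI M \<zeta> \<le> c\<^sup>2 * alpha_gPI M (\<xi> x)"
  using assms(4) eventually_componentwise_ratio[OF assms(3,5,6)]
  by eventually_elim (use assms(1-3,6) in \<open>auto intro!: alpha_gPI_compare\<close>)

lemma continuous_on_alpha_gPI:
  fixes M :: "real^'z^'z"
  assumes "CARD('z) \<ge> 2" "generator M"
  shows "continuous_on pos_prob (alpha_gPI M)"
  unfolding continuous_on_def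
proof
  fix \<zeta> :: "real^'z" assume "\<zeta> \<in> pos_prob"
  then show "(alpha_gPI M \<longlongrightarrow> alpha_gPI M \<zeta>) (at \<zeta> within pos_prob)"
    using assms
    by (intro tendsto_of_multiplicative_bounds[where n = 2] eventually_alpha_gPI_bounds)
       (auto simp: eventually_at_filter)
qed

section \<open>Normalised forms of the infimum\<close>

text \<open>The two sets of values coincide, so the infima agree without any estimate. Assumption
  \<open>norm\<close> says that \<open>S\<close> meets every affine class of nonconstant functions;
  a separate \<open>g\<close> allows the denominator to be dropped where the variance is 1.\<close>

lemma alpha_gPI_eq_INF:
  assumes \<zeta>: "\<zeta> \<in> pos_prob"
    and sub: "\<And>f. f \<in> S \<Longrightarrow> f \<notin> span {vec 1}"
    and norm: "\<And>f. f \<notin> span {vec 1} \<Longrightarrow> \<exists>t a. t \<noteq> 0 \<and> (\<chi> z. t * f$z + a) \<in> S"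
    and g: "\<And>f. f \<in> S \<Longrightarrow> g f = gen_dirichlet M \<zeta> f / var \<zeta> f"
  shows "alpha_gPI M \<zeta> = (INF f\<in>S. g f)"
proof -
  have "(\<lambda>f. gen_dirichlet M \<zeta> f / var \<zeta> f) ` {f. f \<notin> span {vec 1}} = g ` S"
  proof (intro equalityI subsetI)
    fix y assume "y \<in> (\<lambda>f. gen_dirichlet M \<zeta> f / var \<zeta> f) ` {f. f \<notin> span {vec 1}}"
    then obtain f where f: "f \<notin> span {vec 1}" "y = gen_dirichlet M \<zeta> f / var \<zeta> f" by auto
    then obtain t a where ta: "t \<noteq> 0" "(\<chi> z. t * f$z + a) \<in> S" using norm by blast
    then have "y = g (\<chi> z. t * f$z + a)"
      using f(2) g[OF ta(2)] quotient_affine[OF \<zeta> ta(1), of M f a] by simp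
    then show "y \<in> g ` S" using ta by blast
  qed (use sub g in auto)
  then show ?thesis by (simp add: alpha_gPI_def)
qed

text \<open>For centred functions the squared weighted norm is the variance, so the constraint means
  mean 0 and variance 1, and the affine map is standardisation.\<close>

lemma alpha_gPI_wperp:
  fixes M :: "real^'z^'z"
  assumes \<zeta>: "\<zeta> \<in> pos_prob"
  shows "alpha_gPI M \<zeta> = (INF f\<in>{f \<in> one_wperp \<zeta>. wnorm \<zeta> f = 1}. gen_dirichlet M \<zeta> f)"
proof (rule alpha_gPI_eq_INF[OF \<zeta>])
  have v: "var \<zeta> f = (wnorm \<zeta> f)\<^sup>2" if "expect \<zeta> f = 0" for f
    using sum_squared_deviation[OF \<zeta>, of f 0] that by (simp add: wnorm_squared[OF \<zeta>])
  have mem: "f \<in> {f \<in> one_wperp \<zeta>. wnorm \<zeta> f = 1} \<longleftrightarrow> expect \<zeta> f = 0 \<and> var \<zeta> f = 1" for f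
    using v[of f] power2_eq_1_iff[of "wnorm \<zeta> f"] wnorm_nonneg[OF \<zeta>, of f]
    by (auto simp: one_wperp_def expect_def)
  fix f :: "real^'z"
  {
    assume "f \<in> {f \<in> one_wperp \<zeta>. wnorm \<zeta> f = 1}"
    then have f: "expect \<zeta> f = 0" "var \<zeta> f = 1" using mem by blast+
    then show "gen_dirichlet M \<zeta> f = gen_dirichlet M \<zeta> f / var \<zeta> f" by simp
    show "f \<notin> span {vec 1}"
    proof
      assume "f \<in> span {vec 1}"
      then obtain a where a: "\<And>z. f$z = a" using not_in_span_one_iff by blast
      \<comment> \<open>A constant is an affine image with slope 0, hence has variance 0.\<close>
      have "f = (\<chi> z. 0 * f$z + a)" by (simp add: vec_eq_iff a)
      then show False using var_affine[OF \<zeta>, of 0 f a] f by simp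
    qed
  }
  assume f: "f \<notin> span {vec 1}"
  define t where "t = 1 / sqrt (var \<zeta> f)"
  have "t \<noteq> 0" "t\<^sup>2 * var \<zeta> f = 1" using var_pos[OF \<zeta> f] by (auto simp: t_def power_divide)
  then show "\<exists>t a. t \<noteq> 0 \<and> (\<chi> z. t * f$z + a) \<in> {f \<in> one_wperp \<zeta>. wnorm \<zeta> f = 1}"
    unfolding mem expect_affine[OF \<zeta>] var_affine[OF \<zeta>]
    by (intro exI[of _ t] exI[of _ "- t * expect \<zeta> f"]) simp
qed

text \<open>Here the arithmetic mean is subtracted and the Euclidean norm scaled to 1, so the
  feasible set does not depend on \<open>\<zeta>\<close>; the variance is not fixed and stays in the
  quotient.\<close>

lemma alpha_gPI_perp:
  fixes M :: "real^'z^'z"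
  assumes \<zeta>: "\<zeta> \<in> pos_prob"
  shows "alpha_gPI M \<zeta> = (INF f\<in>{f \<in> one_perp. norm f = 1}. gen_dirichlet M \<zeta> f / var \<zeta> f)"
proof (rule alpha_gPI_eq_INF[OF \<zeta>, where S = "{f \<in> one_perp. norm f = 1}"
      and g = "\<lambda>f. gen_dirichlet M \<zeta> f / var \<zeta> f"])
  fix f :: "real^'z"
  {
    assume f: "f \<in> {f \<in> one_perp. norm f = 1}"
    show "f \<notin> span {vec 1}"
    proof
      assume "f \<in> span {vec 1}"
      then obtain a where a: "\<And>z. f$z = a" using not_in_span_one_iff by blast
      then have "a = 0" using f by (simp add: one_perp_def)
      then have "f = 0" using a by (simp add: vec_eq_iff)
      then show False using f by simp
    qed
  }
  assume f: "f \<notin> span {vec 1}"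
  define m where "m = (\<Sum>z\<in>UNIV. f$z) / CARD('z)"
  define g where "g = (\<chi> z. f$z - m)"
  have "g \<noteq> 0" using f unfolding not_in_span_one_iff by (auto simp: g_def vec_eq_iff)
  have eq: "(\<chi> z. (1 / norm g) * f$z + - m / norm g) = (1 / norm g) *\<^sub>R g"
    by (simp add: g_def vec_eq_iff diff_divide_distrib)
  have "(\<Sum>z\<in>UNIV. g$z) = 0" by (simp add: g_def sum_subtractf m_def)
  then have "(1 / norm g) *\<^sub>R g \<in> {f \<in> one_perp. norm f = 1}"
    using \<open>g \<noteq> 0\<close> by (simp add: one_perp_def flip: sum_divide_distrib)
  then show "\<exists>t a. t \<noteq> 0 \<and> (\<chi> z. t * f$z + a) \<in> {f \<in> one_perp. norm f = 1}"
    using \<open>g \<noteq> 0\<close> eq by (intro exI[of _ "1 / norm g"] exI[of _ "- m / norm g"]) simp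
qed (rule refl)

section \<open>Fisher information and entropy near the density 1\<close>

lemma gen_fisher_bounds:
  fixes M :: "real^'z^'z"
  assumes "generator M" "\<zeta> \<in> pos_prob"
    and "\<And>z z'. (\<phi>$z - \<phi>$z')\<^sup>2 / 2 \<le> c * (\<phi>$z * (\<phi>$z' / \<phi>$z - 1 - ln (\<phi>$z' / \<phi>$z))) \<and>
      \<phi>$z * (\<phi>$z' / \<phi>$z - 1 - ln (\<phi>$z' / \<phi>$z)) \<le> c * ((\<phi>$z - \<phi>$z')\<^sup>2 / 2)"
  shows "gen_dirichlet M \<zeta> \<phi> \<le> c * gen_fisher M \<zeta> \<phi>"
    and "gen_fisher M \<zeta> \<phi> \<le> c * gen_dirichlet M \<zeta> \<phi>"
proof -
  let ?R = "\<lambda>z z'. \<phi>$z * (\<phi>$z' / \<phi>$z - 1 - ln (\<phi>$z' / \<phi>$z))"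
  have E: "gen_dirichlet M \<zeta> \<phi> =
      (\<Sum>z\<in>UNIV. \<Sum>z'\<in>UNIV. M$z$z' * \<zeta>$z * ((\<phi>$z - \<phi>$z')\<^sup>2 / 2))"
    unfolding gen_dirichlet_def sum_distrib_left by (intro sum.cong) auto
  have R: "gen_fisher M \<zeta> \<phi> = (\<Sum>z\<in>UNIV. \<Sum>z'\<in>UNIV. M$z$z' * \<zeta>$z * ?R z z')"
    by (simp add: gen_fisher_def mult.assoc)
  have w: "M$z$z' * \<zeta>$z \<ge> 0" if "z \<noteq> z'" for z z'
    using generatorD[OF assms(1) that] pos_probD(1)[OF assms(2), of z] by simp
  have diag: "?R z z = 0" for z by simp
  have "M$z$z' * \<zeta>$z * ((\<phi>$z - \<phi>$z')\<^sup>2 / 2) \<le> c * (M$z$z' * \<zeta>$z * ?R z z')" for z z'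
  proof (cases "z = z'")
    case False
    then show ?thesis
      using mult_left_mono[OF conjunct1[OF assms(3)[of z z']] w[OF False]] by (simp only: mult_ac)
  qed simp
  then show "gen_dirichlet M \<zeta> \<phi> \<le> c * gen_fisher M \<zeta> \<phi>"
    unfolding E R by (intro sum_le_multiple)
  have "M$z$z' * \<zeta>$z * ?R z z' \<le> c * (M$z$z' * \<zeta>$z * ((\<phi>$z - \<phi>$z')\<^sup>2 / 2))" for z z'
  proof (cases "z = z'")
    case False
    then show ?thesis
      using mult_left_mono[OF conjunct2[OF assms(3)[of z z']] w[OF False]] by (simp only: mult_ac)
  qed simp
  then show "gen_fisher M \<zeta> \<phi> \<le> c * gen_dirichlet M \<zeta> \<phi>"
    unfolding E R by (intro sum_le_multiple)
qed

text \<open>Since \<open>\<phi>\<close> has mean 1 and \<open>\<zeta>\<close> mass 1, adding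
  \<open>1 - \<phi>$z\<close> to \<open>\<phi>$z * ln (\<phi>$z)\<close> leaves the entropy
  unchanged. It cancels the linear term at 1, so the comparison with the variance can be made state
  by state.\<close>

lemma rel_entropy_bounds:
  assumes "\<zeta> \<in> pos_prob" "expect \<zeta> \<phi> = 1"
    and "\<And>z. (\<phi>$z - 1)\<^sup>2 / 2 \<le> c * (\<phi>$z * ln (\<phi>$z) - \<phi>$z + 1) \<and>
      \<phi>$z * ln (\<phi>$z) - \<phi>$z + 1 \<le> c * ((\<phi>$z - 1)\<^sup>2 / 2)"
  shows "var \<zeta> \<phi> / 2 \<le> c * rel_entropy \<zeta> \<phi>"
    and "rel_entropy \<zeta> \<phi> \<le> c * (var \<zeta> \<phi> / 2)"
proof -
  have V: "var \<zeta> \<phi> / 2 = (\<Sum>z\<in>UNIV. \<zeta>$z * ((\<phi>$z - 1)\<^sup>2 / 2))"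
    using sum_squared_deviation[OF assms(1), of \<phi> 1] assms(2)
    by (simp add: mult.commute flip: sum_divide_distrib)
  have "(\<Sum>z\<in>UNIV. \<zeta>$z * (\<phi>$z * ln (\<phi>$z) - \<phi>$z + 1)) =
      rel_entropy \<zeta> \<phi> - expect \<zeta> \<phi> + (\<Sum>z\<in>UNIV. \<zeta>$z)"
    by (simp add: rel_entropy_def expect_def algebra_simps sum.distrib sum_subtractf)
  then have H: "rel_entropy \<zeta> \<phi> = (\<Sum>z\<in>UNIV. \<zeta>$z * (\<phi>$z * ln (\<phi>$z) - \<phi>$z + 1))"
    using assms(2) pos_probD(2)[OF assms(1)] by simp
  note w = less_imp_le[OF pos_probD(1)[OF assms(1)]]
  show "var \<zeta> \<phi> / 2 \<le> c * rel_entropy \<zeta> \<phi>" unfolding V H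
    using mult_left_mono[OF conjunct1[OF assms(3)] w]
    by (intro sum_le_multiple) (simp only: mult.left_commute[of c])
  show "rel_entropy \<zeta> \<phi> \<le> c * (var \<zeta> \<phi> / 2)" unfolding V H
    using mult_left_mono[OF conjunct2[OF assms(3)] w]
    by (intro sum_le_multiple) (simp only: mult.left_commute[of c])
qed

lemma wnorm_sub_one_squared:
  assumes "\<zeta> \<in> pos_prob" "expect \<zeta> \<phi> = 1"
  shows "(wnorm \<zeta> (\<phi> - vec 1))\<^sup>2 = var \<zeta> \<phi>"
  using sum_squared_deviation[OF assms(1), of \<phi> 1] assms(2)
  by (simp add: wnorm_squared[OF assms(1)])

text \<open>One summand is at most the whole sum. The condition on \<open>d\<close> compensates for
  a small weight \<open>\<zeta>$z\<close> and turns the weighted bound into a pointwise one.\<close>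

lemma component_less_of_wnorm_less:
  assumes \<zeta>: "\<zeta> \<in> pos_prob" and "wnorm \<zeta> f < d" "\<eta> > 0" "d\<^sup>2 \<le> \<eta>\<^sup>2 * \<zeta>$z"
  shows "\<bar>f$z\<bar> < \<eta>"
proof -
  have "(f$z)\<^sup>2 * \<zeta>$z \<le> (\<Sum>z\<in>UNIV. (f$z)\<^sup>2 * \<zeta>$z)"
    using pos_probD(1)[OF \<zeta>] by (intro member_le_sum) (auto simp: less_imp_le)
  also have "\<dots> = (wnorm \<zeta> f)\<^sup>2" by (simp add: wnorm_squared[OF \<zeta>])
  also have "\<dots> < d\<^sup>2" using assms(2) wnorm_nonneg[OF \<zeta>] by (intro power_strict_mono) auto
  also note assms(4)
  finally have "(f$z)\<^sup>2 < \<eta>\<^sup>2" using pos_probD(1)[OF \<zeta>, of z] by simp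
  then show ?thesis using \<open>\<eta> > 0\<close> by (metis abs_le_square_iff abs_of_pos linorder_not_le)
qed

text \<open>The density is \<open>1 + t * (f - m)\<close> with \<open>m\<close> the mean of
  \<open>f\<close>: it has mean 1, is positive for small \<open>t > 0\<close>, and its squared
  distance to 1 is \<open>t\<^sup>2 * var \<zeta> f\<close>, positive and arbitrarily small.\<close>

lemma density_representative:
  assumes \<zeta>: "\<zeta> \<in> pos_prob" and f: "f \<notin> span {vec 1}" and "d > 0"
  obtains t a where "t \<noteq> 0" "(\<chi> z. t * f$z + a) \<in> densities \<zeta>"
    "0 < wnorm \<zeta> ((\<chi> z. t * f$z + a) - vec 1)" "wnorm \<zeta> ((\<chi> z. t * f$z + a) - vec 1) < d"
proof -
  define m where "m = expect \<zeta> f"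
  define \<phi> where "\<phi> t = (\<chi> z. t * f$z + (1 - t * m))" for t
  have E: "expect \<zeta> (\<phi> t) = 1" for t by (simp add: \<phi>_def expect_affine[OF \<zeta>] m_def)
  have "((\<lambda>t. t * f$z + (1 - t * m)) \<longlongrightarrow> 0 * f$z + (1 - 0 * m)) (at_right 0)" for z
    by (intro tendsto_intros)
  from order_tendstoD(1)[OF this, of 0]
  have "\<forall>\<^sub>F t in at_right 0. \<phi> t$z > 0" for z by (simp add: \<phi>_def)
  then have pos: "\<forall>\<^sub>F t in at_right 0. \<forall>z. \<phi> t$z > 0" by (rule eventually_all_finite)
  have "((\<lambda>t. t\<^sup>2 * var \<zeta> f) \<longlongrightarrow> 0\<^sup>2 * var \<zeta> f) (at_right 0)" by (intro tendsto_intros)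
  then have small: "\<forall>\<^sub>F t in at_right 0. t\<^sup>2 * var \<zeta> f < d\<^sup>2"
    using \<open>d > 0\<close> by (intro order_tendstoD) auto
  have "\<forall>\<^sub>F t::real in at_right 0. t > 0" by (rule eventually_at_right_less)
  with pos small have "\<forall>\<^sub>F t in at_right 0. (\<forall>z. \<phi> t$z > 0) \<and> t\<^sup>2 * var \<zeta> f < d\<^sup>2 \<and> t > 0"
    by eventually_elim auto
  then obtain t where t: "\<And>z. \<phi> t$z > 0" "t\<^sup>2 * var \<zeta> f < d\<^sup>2" "t > 0"
    using eventually_happens trivial_limit_at_right_real by blast
  have "(wnorm \<zeta> (\<phi> t - vec 1))\<^sup>2 = t\<^sup>2 * var \<zeta> f"
    unfolding wnorm_sub_one_squared[OF \<zeta> E] by (simp add: \<phi>_def var_affine[OF \<zeta>])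
  then have "0 < (wnorm \<zeta> (\<phi> t - vec 1))\<^sup>2" "(wnorm \<zeta> (\<phi> t - vec 1))\<^sup>2 < d\<^sup>2"
    using t var_pos[OF \<zeta> f] by auto
  then have "0 < wnorm \<zeta> (\<phi> t - vec 1)" "wnorm \<zeta> (\<phi> t - vec 1) < d"
    using wnorm_nonneg[OF \<zeta>, of "\<phi> t - vec 1"] \<open>d > 0\<close> by (auto intro: power2_less_imp_less)
  moreover have "\<phi> t \<in> densities \<zeta>" using t E by (simp add: densities_def)
  ultimately show ?thesis using that[of t "1 - t * m"] t(3) unfolding \<phi>_def by auto
qed

text \<open>The radius \<open>\<eta>\<close> is chosen before \<open>\<zeta>\<close> and
  \<open>d\<close>, so it serves a whole family of measures. Fisher information and entropy each
  cost \<open>c\<^sup>2\<close>, whence \<open>c^4\<close>; the factor 2 arises because the entropy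
  is close to half the variance.\<close>

lemma entropy_quotient_bounds:
  fixes M :: "real^'z^'z"
  assumes card: "CARD('z) \<ge> 2" and M: "generator M" and c: "c > 1"
  obtains \<eta> where "\<eta> > 0"
    "\<And>\<zeta> d. \<zeta> \<in> pos_prob \<Longrightarrow> d > 0 \<Longrightarrow> (\<And>z. d\<^sup>2 \<le> \<eta>\<^sup>2 * \<zeta>$z) \<Longrightarrow>
      (INF \<phi>\<in>{\<phi> \<in> densities \<zeta>. 0 < wnorm \<zeta> (\<phi> - vec 1) \<and> wnorm \<zeta> (\<phi> - vec 1) < d}.
        gen_fisher M \<zeta> \<phi> / rel_entropy \<zeta> \<phi>) \<le> c^4 * (2 * alpha_gPI M \<zeta>) \<and>
      2 * alpha_gPI M \<zeta> \<le> c^4 *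
      (INF \<phi>\<in>{\<phi> \<in> densities \<zeta>. 0 < wnorm \<zeta> (\<phi> - vec 1) \<and> wnorm \<zeta> (\<phi> - vec 1) < d}.
        gen_fisher M \<zeta> \<phi> / rel_entropy \<zeta> \<phi>)"
proof -
  obtain \<eta>1 where \<eta>1: "\<eta>1 > 0" "\<And>a b. \<bar>a - 1\<bar> < \<eta>1 \<Longrightarrow> \<bar>b - 1\<bar> < \<eta>1 \<Longrightarrow>
    (a - b)\<^sup>2 / 2 \<le> c\<^sup>2 * (a * (b / a - 1 - ln (b / a))) \<and>
    a * (b / a - 1 - ln (b / a)) \<le> c\<^sup>2 * ((a - b)\<^sup>2 / 2)"
    using fisher_term_bounds[OF c] by blast
  have c2: "c\<^sup>2 > 1" using c by (simp add: one_less_power)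
  obtain \<eta>2 where \<eta>2: "\<eta>2 > 0" "\<And>a. \<bar>a - 1\<bar> < \<eta>2 \<Longrightarrow>
    (a - 1)\<^sup>2 / 2 \<le> c\<^sup>2 * (a * ln a - a + 1) \<and> a * ln a - a + 1 \<le> c\<^sup>2 * ((a - 1)\<^sup>2 / 2)"
    using entropy_term_bounds[OF c2] by blast
  define \<eta> where "\<eta> = min \<eta>1 \<eta>2"
  let ?S = "\<lambda>\<zeta> d. {\<phi> \<in> densities \<zeta>.
    0 < wnorm \<zeta> (\<phi> - vec 1) \<and> wnorm \<zeta> (\<phi> - vec 1) < d}"
  have "\<eta> > 0" using \<eta>1 \<eta>2 by (simp add: \<eta>_def)
  moreover have "(INF \<phi>\<in>?S \<zeta> d. gen_fisher M \<zeta> \<phi> / rel_entropy \<zeta> \<phi>) \<le> c^4 * (2 * alpha_gPI M \<zeta>) \<and>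
      2 * alpha_gPI M \<zeta> \<le> c^4 * (INF \<phi>\<in>?S \<zeta> d. gen_fisher M \<zeta> \<phi> / rel_entropy \<zeta> \<phi>)"
    (is "?I \<le> _ \<and> _ \<le> _ * ?I")
    if \<zeta>: "\<zeta> \<in> pos_prob" and d: "d > 0" and dz: "\<And>z. d\<^sup>2 \<le> \<eta>\<^sup>2 * \<zeta>$z" for \<zeta> d
  proof -
    let ?Q = "\<lambda>f. gen_dirichlet M \<zeta> f / var \<zeta> f"
    have key: "2 * ?Q \<phi> \<le> c^4 * (gen_fisher M \<zeta> \<phi> / rel_entropy \<zeta> \<phi>)"
        "gen_fisher M \<zeta> \<phi> / rel_entropy \<zeta> \<phi> \<le> c^4 * (2 * ?Q \<phi>)"
        "\<phi> \<notin> span {vec 1}"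
      if \<phi>: "\<phi> \<in> ?S \<zeta> d" for \<phi>
    proof -
      have E: "expect \<zeta> \<phi> = 1" using \<phi> by (simp add: densities_def)
      have near: "\<bar>\<phi>$z - 1\<bar> < \<eta>" for z
        using component_less_of_wnorm_less[OF \<zeta> _ \<open>\<eta> > 0\<close> dz, of "\<phi> - vec 1" z] \<phi> by simp
      then have near': "\<bar>\<phi>$z - 1\<bar> < \<eta>1" "\<bar>\<phi>$z - 1\<bar> < \<eta>2" for z by (simp_all add: \<eta>_def)
      note R = gen_fisher_bounds[OF M \<zeta> \<eta>1(2)[OF near'(1) near'(1)]]
      note H = rel_entropy_bounds[OF \<zeta> E \<eta>2(2)[OF near'(2)]]
      have "wnorm \<zeta> (\<phi> - vec 1) > 0" using \<phi> by blast
      then have V: "var \<zeta> \<phi> > 0"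
        unfolding wnorm_sub_one_squared[OF \<zeta> E, symmetric] by (rule zero_less_power)
      \<comment> \<open>The signs of entropy and Fisher information, required by
        \<open>frac_le\<close>, are read off from the comparisons themselves.\<close>
      have "0 < c\<^sup>2 * rel_entropy \<zeta> \<phi>" using H(1) V by linarith
      then have Hpos: "rel_entropy \<zeta> \<phi> > 0" using c2 by (simp add: zero_less_mult_iff)
      have Epos: "gen_dirichlet M \<zeta> \<phi> \<ge> 0" by (rule gen_dirichlet_nonneg[OF M \<zeta>])
      have "0 \<le> c\<^sup>2 * gen_fisher M \<zeta> \<phi>" using R(1) Epos by linarith
      then have Rpos: "gen_fisher M \<zeta> \<phi> \<ge> 0" using c2 by (auto simp: zero_le_mult_iff)
      have H': "rel_entropy \<zeta> \<phi> / c\<^sup>2 \<le> var \<zeta> \<phi> / 2"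
        "var \<zeta> \<phi> / 2 / c\<^sup>2 \<le> rel_entropy \<zeta> \<phi>"
        using H pos_divide_le_eq[of "c\<^sup>2"] c2
        by (simp_all only: mult.commute[of _ "c\<^sup>2"])
      have "2 * ?Q \<phi> = gen_dirichlet M \<zeta> \<phi> / (var \<zeta> \<phi> / 2)" by simp
      also have "\<dots> \<le> (c\<^sup>2 * gen_fisher M \<zeta> \<phi>) / (rel_entropy \<zeta> \<phi> / c\<^sup>2)"
        by (rule frac_le) (use R(1) H'(1) Hpos Rpos c in simp_all)
      also have "\<dots> = c^4 * (gen_fisher M \<zeta> \<phi> / rel_entropy \<zeta> \<phi>)"
        using c by (simp add: power2_eq_square power4_eq_xxxx)
      finally show "2 * ?Q \<phi> \<le> c^4 * (gen_fisher M \<zeta> \<phi> / rel_entropy \<zeta> \<phi>)" .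
      have "gen_fisher M \<zeta> \<phi> / rel_entropy \<zeta> \<phi> \<le>
          (c\<^sup>2 * gen_dirichlet M \<zeta> \<phi>) / (var \<zeta> \<phi> / 2 / c\<^sup>2)"
        by (rule frac_le) (use R(2) H'(2) Epos c V in simp_all)
      also have "\<dots> = c^4 * (2 * ?Q \<phi>)"
        using c by (simp add: power2_eq_square power4_eq_xxxx)
      finally show "gen_fisher M \<zeta> \<phi> / rel_entropy \<zeta> \<phi> \<le> c^4 * (2 * ?Q \<phi>)" .
      show "\<phi> \<notin> span {vec 1}"
      proof
        assume "\<phi> \<in> span {vec 1}"
        then obtain a where a: "\<And>z. \<phi>$z = a" using not_in_span_one_iff by blast
        have "\<phi> = (\<chi> z. 0 * \<phi>$z + a)" by (simp add: vec_eq_iff a)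
        then show False using var_affine[OF \<zeta>, of 0 \<phi> a] V by simp
      qed
    qed
    have c4: "c^4 > 0" using c by simp
    have lower: "2 * alpha_gPI M \<zeta> / c^4 \<le> gen_fisher M \<zeta> \<phi> / rel_entropy \<zeta> \<phi>"
      if "\<phi> \<in> ?S \<zeta> d" for \<phi>
    proof -
      have "2 * alpha_gPI M \<zeta> \<le> 2 * ?Q \<phi>" using alpha_gPI_le[OF M \<zeta> key(3)[OF that]] by simp
      also note key(1)[OF that]
      finally show ?thesis using c4 by (simp add: divide_le_eq mult.commute)
    qed
    then have bdd: "bdd_below ((\<lambda>\<phi>. gen_fisher M \<zeta> \<phi> / rel_entropy \<zeta> \<phi>) ` ?S \<zeta> d)"
      by (intro bdd_belowI2)
    have "?S \<zeta> d \<noteq> {}"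
      using nonconstant_exists[OF card] density_representative[OF \<zeta> _ d] by blast
    then have "2 * alpha_gPI M \<zeta> / c^4 \<le> ?I" by (rule cINF_greatest) (rule lower)
    then have lo: "2 * alpha_gPI M \<zeta> \<le> c^4 * ?I" using c4 by (simp add: divide_le_eq mult.commute)
    \<comment> \<open>Every nonconstant \<open>f\<close> has an affine image in the small ball of
      densities with the same Poincare quotient, so restricting to that ball does not raise the
      infimum.\<close>
    have "?I / c^4 / 2 \<le> alpha_gPI M \<zeta>"
    proof (rule alpha_gPI_greatest[OF card])
      fix f :: "real^'z" assume f: "f \<notin> span {vec 1}"
      obtain t a where ta: "t \<noteq> 0" "(\<chi> z. t * f$z + a) \<in> ?S \<zeta> d"
        by (rule density_representative[OF \<zeta> f d]) (rule that, assumption, blast)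
      have "?I \<le> c^4 * (2 * ?Q (\<chi> z. t * f$z + a))"
        using cINF_lower[OF bdd ta(2)] key(2)[OF ta(2)] by linarith
      then have "?I / c^4 \<le> 2 * ?Q f"
        unfolding quotient_affine[OF \<zeta> ta(1)] pos_divide_le_eq[OF c4] by (simp only: mult.commute)
      then show "?I / c^4 / 2 \<le> ?Q f"
        by (subst divide_le_eq_numeral1) (simp only: mult.commute)
    qed
    then have "?I / c^4 \<le> 2 * alpha_gPI M \<zeta>"
      unfolding divide_le_eq_numeral1 by (simp only: mult.commute)
    then have "?I \<le> c^4 * (2 * alpha_gPI M \<zeta>)"
      unfolding pos_divide_le_eq[OF c4] by (simp only: mult.commute)
    with lo show ?thesis by (rule conjI[rotated])
  qed
  ultimately show ?thesis by (rule that)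
qed

section \<open>Continuity, normalised forms and the entropy limit combined\<close>

theorem proposition3p5:
  fixes M :: "real^'z^'z"
  assumes "CARD('z) \<ge> 2"
    and "irreducible_generator M"
  shows "continuous_on pos_prob (alpha_gPI M) \<and>
    (\<forall>\<zeta>\<in>pos_prob.
       alpha_gPI M \<zeta> = (INF f\<in>{f \<in> one_wperp \<zeta>. wnorm \<zeta> f = 1}. gen_dirichlet M \<zeta> f) \<and>
       alpha_gPI M \<zeta> = (INF f\<in>{f \<in> one_perp. norm f = 1}. gen_dirichlet M \<zeta> f / var \<zeta> f)) \<and>
    (\<forall>\<zeta>\<in>pos_prob. \<forall>(\<zeta>s :: real \<Rightarrow> real^'z) (\<delta> :: real \<Rightarrow> real).
       (\<forall>\<epsilon>>0. \<zeta>s \<epsilon> \<in> pos_prob) \<and> (\<zeta>s \<longlongrightarrow> \<zeta>) (at_right 0) \<and>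
       (\<forall>\<epsilon>>0. \<delta> \<epsilon> > 0) \<and> (\<delta> \<longlongrightarrow> 0) (at_right 0) \<longrightarrow>
       (\<exists>L. ((\<lambda>\<epsilon>. INF \<phi>\<in>{\<phi> \<in> densities (\<zeta>s \<epsilon>).
                     0 < wnorm (\<zeta>s \<epsilon>) (\<phi> - vec 1) \<and> wnorm (\<zeta>s \<epsilon>) (\<phi> - vec 1) < \<delta> \<epsilon>}.
                   gen_fisher M (\<zeta>s \<epsilon>) \<phi> / rel_entropy (\<zeta>s \<epsilon>) \<phi>) \<longlongrightarrow> L) (at_right 0) \<and>
            alpha_gPI M \<zeta> = 1/2 * L))"
proof (intro conjI ballI allI impI)
  have M: "generator M" using assms(2) by (simp add: irreducible_generator_def)
  show "continuous_on pos_prob (alpha_gPI M)" by (rule continuous_on_alpha_gPI[OF assms(1) M])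
  fix \<zeta> :: "real^'z" assume \<zeta>: "\<zeta> \<in> pos_prob"
  show "alpha_gPI M \<zeta> = (INF f\<in>{f \<in> one_wperp \<zeta>. wnorm \<zeta> f = 1}. gen_dirichlet M \<zeta> f)"
    by (rule alpha_gPI_wperp[OF \<zeta>])
  show "alpha_gPI M \<zeta> = (INF f\<in>{f \<in> one_perp. norm f = 1}. gen_dirichlet M \<zeta> f / var \<zeta> f)"
    by (rule alpha_gPI_perp[OF \<zeta>])
  fix \<zeta>s :: "real \<Rightarrow> real^'z" and \<delta> :: "real \<Rightarrow> real"
  assume "(\<forall>\<epsilon>>0. \<zeta>s \<epsilon> \<in> pos_prob) \<and> (\<zeta>s \<longlongrightarrow> \<zeta>) (at_right 0) \<and>
       (\<forall>\<epsilon>>0. \<delta> \<epsilon> > 0) \<and> (\<delta> \<longlongrightarrow> 0) (at_right 0)"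
  then have \<zeta>s: "\<And>\<epsilon>. \<epsilon> > 0 \<Longrightarrow> \<zeta>s \<epsilon> \<in> pos_prob" "(\<zeta>s \<longlongrightarrow> \<zeta>) (at_right 0)"
    and \<delta>: "\<And>\<epsilon>. \<epsilon> > 0 \<Longrightarrow> \<delta> \<epsilon> > 0" "(\<delta> \<longlongrightarrow> 0) (at_right 0)" by auto
  have pos: "\<forall>\<^sub>F \<epsilon>::real in at_right 0. \<epsilon> > 0" by (rule eventually_at_right_less)
  have in_prob: "\<forall>\<^sub>F \<epsilon> in at_right 0. \<zeta>s \<epsilon> \<in> pos_prob"
    using pos by eventually_elim (rule \<zeta>s(1))
  let ?I = "\<lambda>\<epsilon>. INF \<phi>\<in>{\<phi> \<in> densities (\<zeta>s \<epsilon>).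
      0 < wnorm (\<zeta>s \<epsilon>) (\<phi> - vec 1) \<and> wnorm (\<zeta>s \<epsilon>) (\<phi> - vec 1) < \<delta> \<epsilon>}.
    gen_fisher M (\<zeta>s \<epsilon>) \<phi> / rel_entropy (\<zeta>s \<epsilon>) \<phi>"
  have "(?I \<longlongrightarrow> 2 * alpha_gPI M \<zeta>) (at_right 0)"
  \<comment> \<open>Passing from the entropy quotient to the Poincare constant of
    \<open>\<zeta>s \<epsilon>\<close> costs \<open>c^4\<close>, and from there to that of
    \<open>\<zeta>\<close> another \<open>c\<^sup>2\<close>.\<close>
  proof (rule tendsto_of_multiplicative_bounds[where n = 6])
    fix c :: real assume c: "c > 1"
    obtain \<eta> where \<eta>: "\<eta> > 0"
      and bounds: "\<And>\<xi> d. \<xi> \<in> pos_prob \<Longrightarrow> d > 0 \<Longrightarrow> (\<And>z. d\<^sup>2 \<le> \<eta>\<^sup>2 * \<xi>$z) \<Longrightarrow>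
      (INF \<phi>\<in>{\<phi> \<in> densities \<xi>. 0 < wnorm \<xi> (\<phi> - vec 1) \<and> wnorm \<xi> (\<phi> - vec 1) < d}.
        gen_fisher M \<xi> \<phi> / rel_entropy \<xi> \<phi>) \<le> c^4 * (2 * alpha_gPI M \<xi>) \<and>
      2 * alpha_gPI M \<xi> \<le> c^4 *
      (INF \<phi>\<in>{\<phi> \<in> densities \<xi>. 0 < wnorm \<xi> (\<phi> - vec 1) \<and> wnorm \<xi> (\<phi> - vec 1) < d}.
        gen_fisher M \<xi> \<phi> / rel_entropy \<xi> \<phi>)"
      using entropy_quotient_bounds[OF assms(1) M c] by blast
    \<comment> \<open>The weights \<open>\<zeta>s \<epsilon>$z\<close> tend to positive limits while
      \<open>\<delta> \<epsilon>\<close> tends to 0, so the smallness condition on \<open>d\<close>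
      in \<open>bounds\<close> eventually holds for \<open>\<delta> \<epsilon>\<close>.\<close>
    have "\<forall>\<^sub>F \<epsilon> in at_right 0. \<forall>z. \<eta>\<^sup>2 * \<zeta>s \<epsilon>$z - (\<delta> \<epsilon>)\<^sup>2 > 0"
    proof (rule eventually_all_finite)
      fix z
      have "((\<lambda>\<epsilon>. \<eta>\<^sup>2 * \<zeta>s \<epsilon>$z - (\<delta> \<epsilon>)\<^sup>2) \<longlongrightarrow> \<eta>\<^sup>2 * \<zeta>$z - 0\<^sup>2) (at_right 0)"
        by (intro tendsto_intros \<zeta>s \<delta>)
      moreover have "\<eta>\<^sup>2 * \<zeta>$z - 0\<^sup>2 > 0" using \<eta> pos_probD(1)[OF \<zeta>, of z] by simp
      ultimately show "\<forall>\<^sub>F \<epsilon> in at_right 0. \<eta>\<^sup>2 * \<zeta>s \<epsilon>$z - (\<delta> \<epsilon>)\<^sup>2 > 0"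
        by (rule order_tendstoD)
    qed
    with pos eventually_alpha_gPI_bounds[OF assms(1) M \<zeta> in_prob \<zeta>s(2) c]
    show "\<forall>\<^sub>F \<epsilon> in at_right 0. ?I \<epsilon> \<le> c^6 * (2 * alpha_gPI M \<zeta>) \<and>
      2 * alpha_gPI M \<zeta> \<le> c^6 * ?I \<epsilon>"
    proof eventually_elim
      case (elim \<epsilon>)
      then have "\<And>z. (\<delta> \<epsilon>)\<^sup>2 \<le> \<eta>\<^sup>2 * \<zeta>s \<epsilon>$z" by (simp add: less_imp_le)
      from bounds[OF \<zeta>s(1)[OF elim(1)] \<delta>(1)[OF elim(1)] this]
      have b: "?I \<epsilon> \<le> c^4 * (2 * alpha_gPI M (\<zeta>s \<epsilon>))" "2 * alpha_gPI M (\<zeta>s \<epsilon>) \<le> c^4 * ?I \<epsilon>"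
        by auto
      note b(1)
      also have "c^4 * (2 * alpha_gPI M (\<zeta>s \<epsilon>)) \<le> c^4 * (2 * (c\<^sup>2 * alpha_gPI M \<zeta>))"
        using c elim(2) by (intro mult_left_mono) auto
      also have "\<dots> = c^6 * (2 * alpha_gPI M \<zeta>)" by (simp add: power_numeral_reduce)
      finally have u: "?I \<epsilon> \<le> c^6 * (2 * alpha_gPI M \<zeta>)" .
      have "2 * alpha_gPI M \<zeta> \<le> c\<^sup>2 * (2 * alpha_gPI M (\<zeta>s \<epsilon>))" using elim(2) by simp
      also have "\<dots> \<le> c\<^sup>2 * (c^4 * ?I \<epsilon>)" using c b(2) by (intro mult_left_mono) auto
      also have "\<dots> = c^6 * ?I \<epsilon>" by (simp add: power_numeral_reduce)
      finally show ?case using u by blast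
    qed
  qed
  then show "\<exists>L. (?I \<longlongrightarrow> L) (at_right 0) \<and> alpha_gPI M \<zeta> = 1/2 * L"
    by (intro exI[of _ "2 * alpha_gPI M \<zeta>"]) simp
qed

end
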